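(* In the group $G_{\operatorname{NAP}}$, let $\mathtt{C}=\sum_{n\geq0}c_n$ be the sum of all corollas, where $c_n$ is the rooted tree consisting of a root with $n$ leaves, and let $\mathtt{L}=\sum_{n\geq0}(-1)^n\ell_n$, where $\ell_n$ is the linear rooted tree (path rooted at an end) with $n+1$ vertices. Then $\mathtt{C}=\mathtt{L}^{-1}$.
   Context: $\operatorname{NAP}(I)$ is the set of rooted trees on vertex set $I$; the composition $t\circ(s_i)_{i\in I}$, for $t\in\operatorname{NAP}(I)$ and $s_i\in\operatorname{NAP}(J_i)$, is the rooted tree on $\coprod_iJ_i$ obtained from the disjoint union of the $s_i$ by adding, for each edge $i$–$i'$ of $t$, an edge between the roots of $s_i$ and $s_{i'}$; its root is the root of $s_k$, $k$ being the root of $t$. $G_{\operatorname{NAP}}$ is the group of formal series $\sum_t a_t\,t$ over unlabeled rooted trees $t$ with rational coefficients and coefficient $1$ on the one-vertex tree, with product $\alpha\times\beta=\sum_{m\geq1}\sum_{n_1,\dots,n_m\geq1}\langle x_m\circ(y_{n_1},\dots,y_{n_m})\rangle$, where $x_m$ (resp. $y_n$) is a labelled representative (linear combination of rooted trees on $\{1,\dots,m\}$, resp. $\{1,\dots,n\}$) of the part of $\alpha$ (resp. $\beta$) with $m$ (resp. $n$) vertices, composition is extended multilinearly, and $\langle\cdot\rangle$ forgets labels. The identity is the one-vertex tree. *)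

theory Defs
  imports Complex_Main "HOL-Library.Multiset"
begin

section \<open>Unlabeled rooted trees\<close>

text \<open>An unlabeled rooted tree is a root together with the multiset of its subtrees.\<close>
datatype rtree = Node "rtree multiset"

primrec nverts :: "rtree \<Rightarrow> nat" where
  "nverts (Node M) = Suc (sum_mset (image_mset nverts M))"

section \<open>Labelled rooted trees\<close>

text \<open>A labelled rooted tree is a pair (root, set of undirected edges); it is a
  rooted tree on the finite vertex set V if the edges are 2-subsets of V, the
  graph is connected and has card V - 1 edges.\<close>
type_synonym ltree = "nat \<times> nat set set"

definition is_rtree_on :: "nat set \<Rightarrow> ltree \<Rightarrow> bool" where
  "is_rtree_on V T \<longleftrightarrow>
     (case T of (r, E) \<Rightarrow>
        finite V \<and> r \<in> V \<and>
        (\<forall>e\<in>E. \<exists>a b. e = {a, b} \<and> a \<noteq> b \<and> a \<in> V \<and> b \<in> V) \<and>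
        card E + 1 = card V \<and>
        (\<forall>v\<in>V. (r, v) \<in> {(a, b). {a, b} \<in> E}\<^sup>*))"

text \<open>Shape of the subtree hanging at v (coming from the parent p, if any).\<close>
inductive shp :: "nat set set \<Rightarrow> nat option \<Rightarrow> nat \<Rightarrow> rtree \<Rightarrow> bool" where
  "(\<forall>w\<in>{w. {v, w} \<in> E \<and> Some w \<noteq> p}. shp E (Some v) w (f w)) \<Longrightarrow>
   shp E p v (Node (image_mset f (mset_set {w. {v, w} \<in> E \<and> Some w \<noteq> p})))"

text \<open>Forgetting labels.\<close>
definition forget :: "ltree \<Rightarrow> rtree" where
  "forget T = (THE u. shp (snd T) None (fst T) u)"

text \<open>A chosen labelled representative on the vertex set {0..<nverts u}.\<close>
definition rep :: "rtree \<Rightarrow> ltree" where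
  "rep u = (SOME T. is_rtree_on {0..<nverts u} T \<and> forget T = u)"

text \<open>Composition t \<circ> (s_0,...,s_{m-1}), t on {0..<m}, s_i on {0..<ns!i}; the
  disjoint union of the J_i is realised as {0..<sum ns} with offsets.\<close>
definition offset :: "nat list \<Rightarrow> nat \<Rightarrow> nat" where
  "offset ns i = sum_list (take i ns)"

definition compose :: "ltree \<Rightarrow> ltree list \<Rightarrow> nat list \<Rightarrow> ltree" where
  "compose t ss ns =
     (let sroot = (\<lambda>i. fst (ss ! i) + offset ns i) in
      (sroot (fst t),
       (\<Union>i<length ss. (\<lambda>e. (\<lambda>x. x + offset ns i) ` e) ` snd (ss ! i)) \<union>
       {{sroot i, sroot j} | i j. {i, j} \<in> snd t}))"

section \<open>The group G_NAP\<close>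

type_synonym nap_series = "rtree \<Rightarrow> rat"

definition G_NAP :: "nap_series set" where
  "G_NAP = {a. a (Node {#}) = 1}"

definition nap_one :: nap_series where
  "nap_one u = (if u = Node {#} then 1 else 0)"

text \<open>Coefficient of u in alpha \<times> beta. Since the composite has \<Sum> n_i
  vertices, only the finitely many terms with \<Sum> n_i = nverts u contribute.\<close>
definition nap_mult :: "nap_series \<Rightarrow> nap_series \<Rightarrow> nap_series" where
  "nap_mult a b u =
     (\<Sum>m\<in>{1..nverts u}.
       \<Sum>ns\<in>{ns. length ns = m \<and> (\<forall>n\<in>set ns. 1 \<le> n) \<and> sum_list ns = nverts u}.
         \<Sum>t\<in>{t. nverts t = m}.
           \<Sum>ss\<in>{ss. length ss = m \<and> (\<forall>i<m. nverts (ss ! i) = ns ! i)}.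
             a t * (\<Prod>i<m. b (ss ! i)) *
             (if forget (compose (rep t) (map rep ss) ns) = u then 1 else 0))"

section \<open>Corollas and linear trees\<close>

definition corolla :: "nat \<Rightarrow> rtree" where
  "corolla n = Node (replicate_mset n (Node {#}))"

primrec lin :: "nat \<Rightarrow> rtree" where
  "lin 0 = Node {#}"
| "lin (Suc n) = Node {#lin n#}"

definition C_series :: nap_series where
  "C_series u = (if \<exists>n. u = corolla n then 1 else 0)"

definition L_series :: nap_series where
  "L_series u = (if \<exists>n. u = lin n then (-1) ^ (THE n. u = lin n) else 0)"

end

theory Submission
  imports "HOL-Combinatorics.Permutations" Defs
begin

text \<open>
  Composing a path with corollas of sizes \<open>k\<^sub>1, \<dots>, k\<^sub>m\<close> gives a caterpillar with \<open>k\<^sub>i\<close> extra leaves at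
  the \<open>i\<close>-th spine vertex, and composing a corolla with paths gives a bunch of paths growing from
  one root. In both products the coefficient of a tree is therefore a signed count of lists of
  numbers describing that tree, and a sign-reversing involution whose only fixed point is the
  list \<open>[0]\<close>, the description of the one-vertex tree, shows that all other coefficients vanish.
\<close>

section \<open>Labelled trees and their shapes\<close>

text \<open>The obstacle is that \<open>rep\<close> picks an arbitrary labelling. Label
  \<open>i\<close> of \<open>rep (lin n)\<close> need not sit at position \<open>i\<close> of the
  path, and the root need not be \<open>0\<close>, so the list of sizes indexing a term of the
  product describes the composite only after a permutation that comes from the chosen labelling.
  This permutation depends on the length of the list alone, and vertex count and coefficients are
  symmetric in the entries, so the sum can be reindexed. Labelled trees are undirected edge sets,
  while recursion over a tree needs a direction. A parent map with a decreasing depth supplies it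
  and turns the shape of a tree into the solution of a recursion over children. The two products
  need different involutions: in one the sign records the number of spine vertices, in the other the
  lengths of the attached paths.\<close>

lemma shp_deterministic: "shp E p v u \<Longrightarrow> shp E p v u' \<Longrightarrow> u = u'"
proof (induction arbitrary: u' rule: shp.induct)
  case (1 v E p f)
  from "1.prems" obtain f' where
    u': "u' = Node (image_mset f' (mset_set {w. {v, w} \<in> E \<and> Some w \<noteq> p}))" and
    f': "\<forall>w\<in>{w. {v, w} \<in> E \<and> Some w \<noteq> p}. shp E (Some v) w (f' w)"
    by (cases rule: shp.cases) auto
  have "f w = f' w" if "w \<in># mset_set {w. {v, w} \<in> E \<and> Some w \<noteq> p}" for w
  proof -
    from that have "w \<in> {w. {v, w} \<in> E \<and> Some w \<noteq> p}"
      by (metis elem_mset_set empty_iff mset_set.infinite set_mset_empty)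
    with "1.IH" f' show ?thesis by blast
  qed
  then show ?case unfolding u' by (intro arg_cong[where f = Node] image_mset_cong)
qed

lemma forget_eqI: "shp (snd T) None (fst T) u \<Longrightarrow> forget T = u"
  unfolding forget_def by (blast intro: shp_deterministic)

text \<open>The function \<open>d\<close> need not be the distance to the root. Any potential that
  drops towards the parent will do, which later allows a lexicographic depth on composites.\<close>

locale parent_tree =
  fixes V :: "nat set" and r :: nat and par :: "nat \<Rightarrow> nat" and d :: "nat \<Rightarrow> nat"
  assumes finite_V: "finite V"
    and root_in: "r \<in> V"
    and par_in: "v \<in> V \<Longrightarrow> v \<noteq> r \<Longrightarrow> par v \<in> V"
    and depth_par: "v \<in> V \<Longrightarrow> v \<noteq> r \<Longrightarrow> d (par v) < d v"
begin

definition kids :: "nat \<Rightarrow> nat set" where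
  "kids v = {w \<in> V. w \<noteq> r \<and> par w = v}"

definition edges :: "nat set set" where
  "edges = (\<lambda>v. {v, par v}) ` (V - {r})"

text \<open>Stands in for \<open>shp\<close>: the shape below each vertex is fixed by an equation
  over its children, with no reference to undirected edges.\<close>

definition shape_fun :: "(nat \<Rightarrow> rtree) \<Rightarrow> bool" where
  "shape_fun g \<longleftrightarrow> (\<forall>v\<in>V. g v = Node (image_mset g (mset_set (kids v))))"

lemma kids_subset: "kids v \<subseteq> V - {r}"
  by (auto simp: kids_def)

lemma finite_kids [simp]: "finite (kids v)"
  using finite_V kids_subset finite_subset by blast

lemma depth_kids: "w \<in> kids v \<Longrightarrow> d v < d w"
  by (auto simp: kids_def depth_par)

text \<open>Depth grows towards the children, so it must be subtracted from its maximum, which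
  exists because \<open>V\<close> is finite. This justifies recursion from the leaves
  upwards.\<close>

lemma wf_kids: "wf {(w, v). w \<in> kids v}"
proof (rule wf_subset)
  show "wf (measure (\<lambda>v. Max (d ` V) - d v))" by simp
  show "{(w, v). w \<in> kids v} \<subseteq> measure (\<lambda>v. Max (d ` V) - d v)"
  proof clarsimp
    fix w v assume w: "w \<in> kids v"
    then have "d w \<le> Max (d ` V)" using finite_V by (intro Max_ge) (auto simp: kids_def)
    with depth_kids[OF w] show "Max (d ` V) - d w < Max (d ` V) - d v" by linarith
  qed
qed

text \<open>Used with two choices of \<open>F\<close>: once for the shapes in a single tree, once
  for the shapes in a composite, where further branches are added at each vertex.\<close>

lemma tree_recursion: "\<exists>H. \<forall>v. H v = F v (image_mset H (mset_set (kids v)))"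
proof -
  let ?R = "{(w, v). w \<in> kids v}"
  define H where "H = wfrec ?R (\<lambda>f v. F v (image_mset f (mset_set (kids v))))"
  have "H v = F v (image_mset H (mset_set (kids v)))" for v
  proof -
    have "H v = F v (image_mset (cut H ?R v) (mset_set (kids v)))"
      unfolding H_def by (subst wfrec[OF wf_kids]) simp
    also have "image_mset (cut H ?R v) (mset_set (kids v)) = image_mset H (mset_set (kids v))"
      by (rule image_mset_cong) (simp add: cut_apply)
    finally show ?thesis .
  qed
  then show ?thesis by blast
qed

lemma shape_fun_exists: "\<exists>g. shape_fun g"
  unfolding shape_fun_def using tree_recursion[of "\<lambda>v. Node"] by blast

text \<open>Links the undirected edges in \<open>shp\<close> to the parent map: an edge at
  \<open>v\<close> goes either to its parent or to a child, and depth prevents a vertex from being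
  both.\<close>

lemma neighbours:
  assumes v: "v \<in> V"
  shows "{w. {v, w} \<in> edges \<and> Some w \<noteq> (if v = r then None else Some (par v))} = kids v"
proof (intro set_eqI iffI)
  fix w
  assume "w \<in> {w. {v, w} \<in> edges \<and> Some w \<noteq> (if v = r then None else Some (par v))}"
  then obtain x where x: "x \<in> V" "x \<noteq> r" "{v, w} = {x, par x}"
    and w: "Some w \<noteq> (if v = r then None else Some (par v))"
    by (auto simp: edges_def)
  from x w have "x = w" "par w = v" by (auto simp: doubleton_eq_iff)
  with x show "w \<in> kids v" by (auto simp: kids_def)
next
  fix w assume w: "w \<in> kids v"
  then have wV: "w \<in> V" "w \<noteq> r" "par w = v" by (auto simp: kids_def)
  have "w \<noteq> par v" if "v \<noteq> r"
    using depth_par[OF v that] depth_kids[OF w] by auto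
  moreover have "{v, w} \<in> edges" using wV by (auto simp: edges_def)
  ultimately show "w \<in> {w. {v, w} \<in> edges \<and> Some w \<noteq> (if v = r then None else Some (par v))}"
    by auto
qed

lemma shp_shape_fun:
  assumes g: "shape_fun g" and "v \<in> V"
  shows "shp edges (if v = r then None else Some (par v)) v (g v)"
  using wf_kids \<open>v \<in> V\<close>
proof (induction v rule: wf_induct_rule)
  case (less v)
  have "shp edges (Some v) w (g w)" if "w \<in> kids v" for w
    using less.IH[of w] that by (auto simp: kids_def)
  then show ?case
    using shp.intros[of v edges "if v = r then None else Some (par v)" g] g less.prems
    unfolding neighbours[OF less.prems] shape_fun_def by auto
qed

lemma forget_edges: "shape_fun g \<Longrightarrow> forget (r, edges) = g r"
  using shp_shape_fun[of g r] root_in by (intro forget_eqI) simp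

text \<open>Two distinct vertices with the same edge would be parents of each other, and each would
  be strictly less deep than the other.\<close>

lemma inj_on_edge: "inj_on (\<lambda>v. {v, par v}) (V - {r})"
proof (rule inj_onI)
  fix v w
  assume vw: "v \<in> V - {r}" "w \<in> V - {r}" "{v, par v} = {w, par w}"
  show "v = w"
  proof (rule ccontr)
    assume "v \<noteq> w"
    with vw(3) have "par v = w" "par w = v" by (auto simp: doubleton_eq_iff)
    with depth_par[of v] depth_par[of w] vw show False by auto
  qed
qed

lemma card_edges: "card edges + 1 = card V"
  unfolding edges_def card_image[OF inj_on_edge]
  using finite_V root_in by (metis Suc_eq_plus1 card_Suc_Diff1)

lemma is_rtree_on_edges: "is_rtree_on V (r, edges)"
proof -
  have "(r, v) \<in> {(a, b). {a, b} \<in> edges}\<^sup>*" if "v \<in> V" for v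
    using that
  proof (induction "d v" arbitrary: v rule: less_induct)
    case less
    show ?case
    proof (cases "v = r")
      case False
      then have "(r, par v) \<in> {(a, b). {a, b} \<in> edges}\<^sup>*"
        using less depth_par par_in by blast
      moreover have "(par v, v) \<in> {(a, b). {a, b} \<in> edges}"
        using False less.prems by (auto simp: edges_def)
      ultimately show ?thesis by (rule rtrancl_into_rtrancl)
    qed simp
  qed
  moreover have "\<exists>a b. e = {a, b} \<and> a \<noteq> b \<and> a \<in> V \<and> b \<in> V" if "e \<in> edges" for e
  proof -
    from that obtain v where "v \<in> V" "v \<noteq> r" "e = {v, par v}" by (auto simp: edges_def)
    moreover from this have "par v \<noteq> v" using depth_par by fastforce
    ultimately show ?thesis using par_in by blast
  qed
  ultimately show ?thesis
    unfolding is_rtree_on_def using finite_V root_in card_edges by auto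
qed

end

text \<open>The edges joining each vertex to its predecessor on a shortest path from the root are
  pairwise distinct, so the edge count leaves no room for others.\<close>
lemma parent_tree_if_is_rtree_on:
  assumes "is_rtree_on V T"
  obtains par d where "parent_tree V (fst T) par d" "snd T = parent_tree.edges V (fst T) par"
proof -
  obtain r E where T: "T = (r, E)" by (cases T)
  let ?R = "{(a, b). {a, b} \<in> E}"
  define d where "d v = (LEAST n. (r, v) \<in> ?R ^^ n)" for v
  have fin: "finite V" and r: "r \<in> V"
    and E: "\<And>e. e \<in> E \<Longrightarrow> \<exists>a b. e = {a, b} \<and> a \<noteq> b \<and> a \<in> V \<and> b \<in> V"
    and cE: "card E + 1 = card V" and conn: "\<And>v. v \<in> V \<Longrightarrow> (r, v) \<in> ?R\<^sup>*"
    using assms by (auto simp: T is_rtree_on_def)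
  have "\<exists>w. {w, v} \<in> E \<and> d w < d v" if v: "v \<in> V" "v \<noteq> r" for v
  proof -
    from conn[OF v(1)] obtain n where "(r, v) \<in> ?R ^^ n" by (auto simp: rtrancl_power)
    then have dv: "(r, v) \<in> ?R ^^ d v" unfolding d_def by (rule LeastI)
    with v(2) obtain k where k: "d v = Suc k" by (cases "d v") auto
    with dv obtain w where w: "(r, w) \<in> ?R ^^ k" "{w, v} \<in> E" by auto
    from w(1) have "d w \<le> k" unfolding d_def by (rule Least_le)
    with k w(2) show ?thesis by auto
  qed
  then obtain par where par: "\<And>v. v \<in> V \<Longrightarrow> v \<noteq> r \<Longrightarrow> {par v, v} \<in> E \<and> d (par v) < d v"
    by metis
  have "par v \<in> V" if "v \<in> V" "v \<noteq> r" for v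
    using par[OF that] E[of "{par v, v}"] by (auto simp: doubleton_eq_iff)
  then interpret parent_tree V r par d
    using fin r par by unfold_locales auto
  have "E \<subseteq> Pow V" using E by blast
  then have "finite E" using fin finite_subset by auto
  moreover have "edges \<subseteq> E" using par by (auto simp: edges_def insert_commute)
  ultimately have "E = edges" using card_edges cE by (metis add_right_cancel card_subset_eq)
  then show thesis using that parent_tree_axioms by (simp add: T)
qed

section \<open>Shape of a composite\<close>

lemma offset_Suc: "i < length ns \<Longrightarrow> offset ns (Suc i) = offset ns i + ns ! i"
  by (simp add: offset_def take_Suc_conv_app_nth)

lemma offset_mono: "i \<le> j \<Longrightarrow> offset ns i \<le> offset ns j"
  unfolding offset_def by (metis le_add1 min.absorb2 take_add le_Suc_ex sum_list_append)

text \<open>Lets a label of a composite be decoded into the index of a component and a vertex of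
  that component.\<close>

lemma inj_on_offset:
  "inj_on (\<lambda>(i, y). y + offset ns i) (SIGMA i:{0..<length ns}. {0..<ns ! i})"
proof -
  have "\<not> i < j" if "i < length ns" "j < length ns" "x < ns ! i"
    and "x + offset ns i = y + offset ns j" for i j x y
  proof
    assume "i < j"
    then have "offset ns i + ns ! i \<le> offset ns j"
      using offset_mono[of "Suc i" j ns] offset_Suc[OF that(1)] by simp
    with that show False by linarith
  qed
  note * = this
  show ?thesis
  proof (rule inj_onI, clarsimp)
    fix i j x y
    assume a: "i < length ns" "j < length ns" "x < ns ! i" "y < ns ! j"
      "x + offset ns i = y + offset ns j"
    have "\<not> i < j" "\<not> j < i" using *[of i j x y] *[of j i y x] a by auto
    then show "i = j \<and> x = y" using a by auto
  qed
qed

text \<open>The children of the root of \<open>s\<^sub>i\<close> in a composite are its children in \<open>s\<^sub>i\<close> together with the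
  roots of the \<open>s\<^sub>j\<close> for the children \<open>j\<close> of \<open>i\<close>; other vertices keep their children.\<close>
lemma forget_compose:
  assumes t: "parent_tree {0..<m} (fst t) part dt"
    and tE: "snd t = parent_tree.edges {0..<m} (fst t) part"
    and len: "length ss = m" "length ns = m"
    and s: "\<And>i. i < m \<Longrightarrow> parent_tree {0..<ns ! i} (fst (ss ! i)) (par i) (d i)"
    and sE: "\<And>i. i < m \<Longrightarrow> snd (ss ! i) = parent_tree.edges {0..<ns ! i} (fst (ss ! i)) (par i)"
    and g: "\<And>i. i < m \<Longrightarrow> parent_tree.shape_fun {0..<ns ! i} (fst (ss ! i)) (par i) (g i)"
    and M: "\<And>i. i < m \<Longrightarrow> forget (ss ! i) = Node (M i)"
    and H: "\<And>i. i < m \<Longrightarrow>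
      H i = Node (M i + image_mset H (mset_set (parent_tree.kids {0..<m} (fst t) part i)))"
  shows "forget (compose t ss ns) = H (fst t)"
proof -
  interpret t: parent_tree "{0..<m}" "fst t" part dt by (rule t)
  define rt where "rt i = fst (ss ! i)" for i
  define S where "S = (SIGMA i:{0..<m}. {0..<ns ! i})"
  define \<phi> where "\<phi> = (\<lambda>(i, y). y + offset ns i)"
  have inj: "inj_on \<phi> S" using inj_on_offset[of ns] by (simp add: S_def \<phi>_def len)
  define dec where "dec = inv_into S \<phi>"
  have dec: "dec (y + offset ns i) = (i, y)" if "i < m" "y < ns ! i" for i y
    using inv_into_f_f[OF inj, of "(i, y)"] that by (auto simp: dec_def S_def \<phi>_def)
  define sroot where "sroot i = rt i + offset ns i" for i
  \<comment> \<open>The root of a component hangs below the root of the parent component. At the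
    root of the whole composite the value is arbitrary, and the locale demands nothing
    there.\<close>
  define par' where "par' x = (case dec x of (i, y) \<Rightarrow>
    if y = rt i then sroot (part i) else par i y + offset ns i)" for x
  \<comment> \<open>\<open>D\<close> exceeds every depth inside a component, so
    \<open>D * dt i + d i y\<close> orders vertices lexicographically, by depth in \<open>t\<close>
    and then by depth in the component.\<close>
  define D where "D = Suc (Max (\<Union>i\<in>{0..<m}. d i ` {0..<ns ! i}))"
  define d' where "d' x = (case dec x of (i, y) \<Rightarrow> D * dt i + d i y)" for x
  \<comment> \<open>Candidate shape function of the composite: only at the roots of components does
    anything new hang, so elsewhere the old shape \<open>g i\<close> persists.\<close>
  define H' where "H' x = (case dec x of (i, y) \<Rightarrow> if y = rt i then H i else g i y)" for x
  have dD: "d i y < D" if "i < m" "y < ns ! i" for i y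
    unfolding D_def less_Suc_eq_le using that by (intro Max_ge finite_UN_I UN_I[of i]) auto
  have rt: "rt i < ns ! i" if "i < m" for i
    using parent_tree.root_in[OF s[OF that]] by (simp add: rt_def)
  have par: "par i y < ns ! i" "d i (par i y) < d i y" if "i < m" "y < ns ! i" "y \<noteq> rt i" for i y
    using parent_tree.par_in[OF s[OF that(1)], of y] parent_tree.depth_par[OF s[OF that(1)], of y] that
    by (auto simp: rt_def)
  have part: "part i < m" "dt (part i) < dt i" if "i < m" "i \<noteq> fst t" for i
    using t.par_in[of i] t.depth_par[of i] that by auto
  have root: "fst t < m" using t.root_in by simp
  have par'_root: "par' (sroot i) = sroot (part i)" if "i < m" for i
    using that rt by (simp add: par'_def sroot_def dec)
  have par'_other: "par' (y + offset ns i) = par i y + offset ns i"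
    if "i < m" "y < ns ! i" "y \<noteq> rt i" for i y
    using that by (simp add: par'_def dec)
  have mem: "y + offset ns i \<in> \<phi> ` S" if "i < m" "y < ns ! i" for i y
    using that unfolding S_def \<phi>_def by (intro image_eqI[of _ _ "(i, y)"]) auto
  have sroot_mem: "sroot i \<in> \<phi> ` S" if "i < m" for i
    using that rt mem by (simp add: sroot_def)
  have cases [consumes 1, case_names 1 2]: P if "x \<in> \<phi> ` S" and "\<And>i. i < m \<Longrightarrow> x = sroot i \<Longrightarrow> P"
    and "\<And>i y. i < m \<Longrightarrow> y < ns ! i \<Longrightarrow> y \<noteq> rt i \<Longrightarrow> x = y + offset ns i \<Longrightarrow> P" for x P
    using that by (fastforce simp: S_def \<phi>_def sroot_def)
  have eq_iff: "y + offset ns i = z + offset ns j \<longleftrightarrow> i = j \<and> y = z"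
    if "i < m" "y < ns ! i" "j < m" "z < ns ! j" for i j y z
    using that dec by (metis prod.inject)
  have sroot_eq: "sroot i = sroot j \<longleftrightarrow> i = j" if "i < m" "j < m" for i j
    using eq_iff that rt unfolding sroot_def by blast
  have inner_neq: "y + offset ns i \<noteq> sroot j"
    if "i < m" "y < ns ! i" "y \<noteq> rt i" "j < m" for i y j
    using that rt eq_iff unfolding sroot_def by blast
  interpret c: parent_tree "\<phi> ` S" "sroot (fst t)" par' d'
  proof
    show "finite (\<phi> ` S)" by (simp add: S_def)
    show "sroot (fst t) \<in> \<phi> ` S" using root sroot_mem by blast
    fix v assume v: "v \<in> \<phi> ` S" "v \<noteq> sroot (fst t)"
    show "par' v \<in> \<phi> ` S"
      using v(1)
    proof (cases rule: cases)
      case (1 i)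
      with v have "i \<noteq> fst t" by auto
      with 1 part[of i] show ?thesis by (simp add: par'_root sroot_mem)
    next
      case (2 i y)
      with par[of i y] show ?thesis by (simp add: par'_other mem)
    qed
    show "d' (par' v) < d' v"
      using v(1)
    proof (cases rule: cases)
      case (1 i)
      have i: "part i < m" "dt (part i) < dt i" using 1 v part[of i] by auto
      have "D * dt (part i) + d (part i) (rt (part i)) < D * Suc (dt (part i))"
        using dD[OF i(1) rt[OF i(1)]] by simp
      also have "\<dots> \<le> D * dt i" using i(2) by (intro mult_le_mono) auto
      finally have "D * dt (part i) + d (part i) (rt (part i)) < D * dt i + d i (rt i)"
        by linarith
      then have "d' (sroot (part i)) < d' (sroot i)"
        using 1 i rt by (simp add: d'_def sroot_def dec)
      with 1 show ?thesis by (simp add: par'_root)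
    next
      case (2 i y)
      with par[of i y] show ?thesis by (simp add: par'_other d'_def dec)
    qed
  qed
  have kids_root: "c.kids (sroot i) = (\<lambda>y. y + offset ns i) `
      parent_tree.kids {0..<ns ! i} (rt i) (par i) (rt i) \<union> sroot ` t.kids i" (is "_ = ?A \<union> ?B")
    if i: "i < m" for i
  proof (intro subset_antisym subsetI)
    fix x assume "x \<in> c.kids (sroot i)"
    then have x: "x \<in> \<phi> ` S" "x \<noteq> sroot (fst t)" "par' x = sroot i" by (auto simp: c.kids_def)
    from x(1) show "x \<in> ?A \<union> ?B"
    proof (cases rule: cases)
      case (1 j)
      with x have j: "j \<noteq> fst t" by auto
      with 1 x part[of j] i have "part j = i" by (simp add: par'_root sroot_eq)
      with 1 j show ?thesis by (auto simp: t.kids_def)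
    next
      case (2 j y)
      with x i rt par[of j y] have "j = i" "par i y = rt i"
        unfolding sroot_def by (auto simp: par'_other eq_iff)
      with 2 i show ?thesis
        using s[OF i] by (auto simp: parent_tree.kids_def rt_def)
    qed
  next
    fix x assume "x \<in> ?A \<union> ?B"
    then show "x \<in> c.kids (sroot i)"
    proof
      assume "x \<in> ?A"
      then obtain y where y: "y < ns ! i" "y \<noteq> rt i" "par i y = rt i" "x = y + offset ns i"
        using s[OF i] by (auto simp: parent_tree.kids_def rt_def)
      then show ?thesis
        using i root inner_neq by (simp add: c.kids_def mem par'_other) (simp add: sroot_def)
    next
      assume "x \<in> ?B"
      then obtain j where "j < m" "j \<noteq> fst t" "part j = i" "x = sroot j"
        by (auto simp: t.kids_def)
      then show ?thesis
        using root by (auto simp: c.kids_def sroot_mem par'_root sroot_eq)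
    qed
  qed
  have kids_other: "c.kids (y + offset ns i) = (\<lambda>y. y + offset ns i) `
      parent_tree.kids {0..<ns ! i} (rt i) (par i) y" (is "_ = ?A")
    if i: "i < m" "y < ns ! i" "y \<noteq> rt i" for i y
  proof (intro subset_antisym subsetI)
    fix x assume "x \<in> c.kids (y + offset ns i)"
    then have x: "x \<in> \<phi> ` S" "x \<noteq> sroot (fst t)" "par' x = y + offset ns i"
      by (auto simp: c.kids_def)
    from x(1) show "x \<in> ?A"
    proof (cases rule: cases)
      case (1 j)
      with x have "j \<noteq> fst t" by auto
      with 1 x part[of j] have "part j < m" "sroot (part j) = y + offset ns i"
        by (simp_all add: par'_root)
      with i inner_neq show ?thesis by metis
    next
      case (2 j z)
      with x i par[of j z] have "j = i" "par i z = y"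
        by (auto simp: par'_other eq_iff)
      with 2 i show ?thesis
        using s[OF i(1)] by (auto simp: parent_tree.kids_def rt_def)
    qed
  next
    fix x assume "x \<in> ?A"
    then obtain z where z: "z < ns ! i" "z \<noteq> rt i" "par i z = y" "x = z + offset ns i"
      using s[OF i(1)] by (auto simp: parent_tree.kids_def rt_def)
    then show "x \<in> c.kids (y + offset ns i)"
      using i root inner_neq by (simp add: c.kids_def mem par'_other)
  qed
  have H'_root: "H' (sroot i) = H i" if "i < m" for i
    using that rt by (simp add: H'_def sroot_def dec)
  have H'_kids: "image_mset H' (mset_set ((\<lambda>y. y + offset ns i) `
        parent_tree.kids {0..<ns ! i} (rt i) (par i) y)) =
      image_mset (g i) (mset_set (parent_tree.kids {0..<ns ! i} (rt i) (par i) y))"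
    (is "image_mset H' (mset_set (_ ` ?K)) = _") if i: "i < m" for i y
  proof -
    have fin: "finite ?K" using parent_tree.finite_kids[OF s[OF i]] by (simp add: rt_def)
    have "image_mset H' (mset_set ((\<lambda>y. y + offset ns i) ` ?K)) =
        image_mset (\<lambda>z. H' (z + offset ns i)) (mset_set ?K)"
      by (simp add: image_mset_mset_set[symmetric] multiset.map_comp o_def)
    also have "\<dots> = image_mset (g i) (mset_set ?K)"
      using i fin s[OF i] by (intro image_mset_cong) (auto simp: H'_def dec parent_tree.kids_def rt_def)
    finally show ?thesis .
  qed
  have "c.shape_fun H'"
    unfolding c.shape_fun_def
  proof
    fix v assume "v \<in> \<phi> ` S"
    then show "H' v = Node (image_mset H' (mset_set (c.kids v)))"
    proof (cases rule: cases)
      case (1 i)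
      let ?K = "parent_tree.kids {0..<ns ! i} (rt i) (par i) (rt i)"
      have fin: "finite ?K" using parent_tree.finite_kids[OF s[OF 1(1)]] by (simp add: rt_def)
      have tk: "j < m" if "j \<in> t.kids i" for j using that by (auto simp: t.kids_def)
      have "(\<lambda>y. y + offset ns i) ` ?K \<inter> sroot ` t.kids i = {}"
        using s[OF 1(1)] 1 tk inner_neq
        by (fastforce simp: parent_tree.kids_def rt_def)
      then have "image_mset H' (mset_set (c.kids v)) =
          image_mset (g i) (mset_set ?K) + image_mset H' (mset_set (sroot ` t.kids i))"
        using 1 fin by (simp add: kids_root mset_set_Union H'_kids)
      also have "image_mset H' (mset_set (sroot ` t.kids i)) = image_mset H (mset_set (t.kids i))"
      proof -
        have "inj_on sroot (t.kids i)" by (rule inj_onI) (simp add: sroot_eq tk)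
        then have "image_mset H' (mset_set (sroot ` t.kids i)) =
            image_mset (\<lambda>j. H' (sroot j)) (mset_set (t.kids i))"
          by (simp add: image_mset_mset_set[symmetric] multiset.map_comp o_def)
        also have "\<dots> = image_mset H (mset_set (t.kids i))"
          by (intro image_mset_cong) (auto simp: H'_root tk)
        finally show ?thesis .
      qed
      \<comment> \<open>\<open>M i\<close> is known only through \<open>forget (ss ! i)\<close>;
        evaluating that at the root by \<open>g i\<close> identifies it with the shapes of the
        root's children.\<close>
      also have "image_mset (g i) (mset_set ?K) = M i"
      proof -
        have "Node (M i) = g i (rt i)"
          using parent_tree.forget_edges[OF s[OF 1(1)] g[OF 1(1)]] M[OF 1(1)] sE[OF 1(1)]
          by (metis prod.collapse rt_def)
        also have "\<dots> = Node (image_mset (g i) (mset_set ?K))"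
          using g[OF 1(1)] s[OF 1(1)] rt[OF 1(1)]
          by (auto simp: parent_tree.shape_fun_def rt_def)
        finally show ?thesis by simp
      qed
      finally show ?thesis using H[OF 1(1)] 1 by (simp add: H'_root)
    next
      case (2 i y)
      then have "H' v = g i y" by (simp add: H'_def dec)
      also have "\<dots> = Node (image_mset (g i) (mset_set (parent_tree.kids {0..<ns ! i} (rt i) (par i) y)))"
        using g[OF 2(1)] s[OF 2(1)] 2 by (auto simp: parent_tree.shape_fun_def rt_def)
      finally show ?thesis using 2 by (simp add: kids_other H'_kids)
    qed
  qed
  then have "forget (sroot (fst t), c.edges) = H' (sroot (fst t))" by (rule c.forget_edges)
  moreover have "compose t ss ns = (sroot (fst t), c.edges)"
  proof -
    have "c.edges = (\<Union>i<m. (\<lambda>e. (\<lambda>x. x + offset ns i) ` e) ` snd (ss ! i)) \<union>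
       {{sroot i, sroot j} | i j. {i, j} \<in> snd t}" (is "_ = ?A \<union> ?B")
    proof (intro subset_antisym subsetI)
      fix e assume "e \<in> c.edges"
      then obtain x where x: "x \<in> \<phi> ` S" "x \<noteq> sroot (fst t)" "e = {x, par' x}"
        by (auto simp: c.edges_def)
      from x(1) show "e \<in> ?A \<union> ?B"
      proof (cases rule: cases)
        case (1 i)
        with x have "{i, part i} \<in> snd t" by (auto simp: tE t.edges_def)
        with 1 x show ?thesis by (auto simp: par'_root)
      next
        case (2 i y)
        with x have "{y, par i y} \<in> snd (ss ! i)"
          using s[OF 2(1)] by (auto simp: sE parent_tree.edges_def rt_def)
        with 2 x show ?thesis
          by (auto simp: par'_other intro!: bexI[of _ i] image_eqI[of _ _ "{y, par i y}"])
      qed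
    next
      fix e assume "e \<in> ?A \<union> ?B"
      then show "e \<in> c.edges"
      proof
        assume "e \<in> ?A"
        then obtain i e' where i: "i < m" "e' \<in> snd (ss ! i)" "e = (\<lambda>x. x + offset ns i) ` e'"
          by auto
        from i(2) obtain y where "y \<in> {0..<ns ! i} - {rt i}" "e' = {y, par i y}"
          unfolding sE[OF i(1)] parent_tree.edges_def[OF s[OF i(1)]] rt_def by blast
        then have y: "y < ns ! i" "y \<noteq> rt i" "e' = {y, par i y}" by auto
        have "y + offset ns i \<noteq> sroot (fst t)"
          using y i root inner_neq by blast
        then show ?thesis
          using y i mem par'_other by (auto simp: c.edges_def)
      next
        assume "e \<in> ?B"
        \<comment> \<open>Writing the edge as an image of the unordered pair allows
          \<open>{i, j}\<close> to be replaced by \<open>{k, part k}\<close> without deciding which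
          end is the parent.\<close>
        then obtain i j where ij: "e = sroot ` {i, j}" "{i, j} \<in> snd t" by auto
        from ij(2) obtain k where "k \<in> {0..<m} - {fst t}" "{i, j} = {k, part k}"
          unfolding tE t.edges_def by blast
        with ij(1) root show ?thesis
          by (auto simp: c.edges_def sroot_mem par'_root sroot_eq intro!: image_eqI[of _ _ "sroot k"])
      qed
    qed
    then show ?thesis by (simp add: compose_def Let_def sroot_def rt_def len)
  qed
  ultimately show ?thesis using root by (simp add: H'_root)
qed

section \<open>Products of series supported on one tree per size\<close>

lemma size_le_sum_nverts: "size M \<le> sum_mset (image_mset nverts M)"
proof (induction M)
  case (add u M)
  moreover have "nverts u \<ge> 1" by (cases u) simp
  ultimately show ?case by simp
qed simp

text \<open>Removing the root of a tree with at most \<open>Suc n\<close> vertices leaves at most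
  \<open>n\<close> branches, each with at most \<open>n\<close> vertices. The bound is an inequality
  so that the induction hypothesis covers all branches. Finiteness is what allows single terms to be
  isolated in the sums over trees.\<close>

lemma finite_nverts_le: "finite {u. nverts u \<le> n}"
proof (induction n)
  case 0
  have "nverts u > 0" for u by (cases u) simp
  then show ?case by (metis (no_types, lifting) Collect_empty_eq finite.emptyI le_zero_eq less_numeral_extra(3))
next
  case (Suc n)
  let ?A = "{u. nverts u \<le> n}"
  have "{u. nverts u \<le> Suc n} \<subseteq> (\<lambda>xs. Node (mset xs)) ` {xs. set xs \<subseteq> ?A \<and> length xs \<le> n}"
  proof
    fix u assume u: "u \<in> {u. nverts u \<le> Suc n}"
    obtain M where M: "u = Node M" by (cases u)
    obtain xs where xs: "mset xs = M" using ex_mset by blast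
    from u M have sum: "sum_mset (image_mset nverts M) \<le> n" by simp
    have "length xs \<le> n"
      using size_le_sum_nverts[of M] sum xs by (metis le_trans size_mset)
    moreover have "nverts v \<le> n" if "v \<in> set xs" for v
    proof -
      from that xs have "v \<in># M" by auto
      then have "nverts v \<le> sum_mset (image_mset nverts M)"
        by (metis image_mset_add_mset insert_DiffM le_add1 sum_mset.insert)
      with sum show ?thesis by simp
    qed
    ultimately show "u \<in> (\<lambda>xs. Node (mset xs)) ` {xs. set xs \<subseteq> ?A \<and> length xs \<le> n}"
      using M xs by auto
  qed
  then show ?case using finite_lists_length_le[OF Suc] finite_surj by blast
qed

lemma sum_eq_single:
  assumes "finite A" "z \<in> A" "\<And>t. t \<in> A \<Longrightarrow> t \<noteq> z \<Longrightarrow> f t = 0"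
  shows "sum f A = f z"
  using assms by (subst sum.remove[of A z]) (auto intro: sum.neutral)

lemma length_le_sum_list_Suc: "length ks \<le> sum_list (map Suc ks)"
  by (induction ks) auto

text \<open>Each series has at most one tree of each size in its support, so the size list
  determines the only term that can survive in the sums over \<open>t\<close> and \<open>ss\<close>.
  Sizes are at least 1 and are recorded by their predecessors \<open>ks\<close>.\<close>

lemma nap_mult_families:
  assumes x: "\<And>n. nverts (x n) = Suc n" and y: "\<And>n. nverts (y n) = Suc n"
    and a: "\<And>u. u \<notin> range x \<Longrightarrow> a u = 0" and b: "\<And>u. u \<notin> range y \<Longrightarrow> b u = 0"
  shows "nap_mult a b u =
    (\<Sum>ks | ks \<noteq> [] \<and> sum_list (map Suc ks) = nverts u \<and>
        forget (compose (rep (x (length ks - 1))) (map (rep \<circ> y) ks) (map Suc ks)) = u.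
      a (x (length ks - 1)) * prod_list (map (b \<circ> y) ks))"
proof -
  define N where "N = nverts u"
  define A where "A m = {ns. length ns = m \<and> (\<forall>n\<in>set ns. 1 \<le> n) \<and> sum_list ns = N}" for m
  define B where "B m ns = {ss. length ss = m \<and> (\<forall>i<m. nverts (ss ! i) = ns ! i)}" for m ns
  define I where "I t ss ns = (if forget (compose (rep t) (map rep ss) ns) = u then 1 else 0 :: rat)"
    for t ss ns
  define G where "G ks = a (x (length ks - 1)) * prod_list (map (b \<circ> y) ks) *
    I (x (length ks - 1)) (map y ks) (map Suc ks)" for ks
  have inner: "(\<Sum>t | nverts t = m. \<Sum>ss\<in>B m ns. a t * (\<Prod>i<m. b (ss ! i)) * I t ss ns) =
      G (map (\<lambda>n. n - 1) ns)"
    if m: "m \<in> {1..N}" and ns: "ns \<in> A m" for m ns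
  proof -
    define ks where "ks = map (\<lambda>n. n - 1) ns"
    have "map Suc ks = ns"
      unfolding ks_def map_map by (rule map_idI) (use ns in \<open>auto simp: A_def\<close>)
    moreover have "length ks = m" using ns by (simp add: ks_def A_def)
    ultimately have ks: "map Suc ks = ns" "length ks = m" by auto
    have fin: "finite {t. nverts t = m}"
      by (rule finite_subset[OF _ finite_nverts_le[of m]]) auto
    have xm: "nverts (x (m - 1)) = m" using x m by simp
    have "B m ns \<subseteq> {ss. set ss \<subseteq> {t. nverts t \<le> N} \<and> length ss = m}"
    proof
      fix ss assume ss: "ss \<in> B m ns"
      have "nverts t \<le> N" if t: "t \<in> set ss" for t
      proof -
        from t ss obtain i where "i < m" "t = ss ! i" by (auto simp: B_def in_set_conv_nth)
        with ss ns have "nverts t \<in> set ns" by (auto simp: B_def A_def)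
        with ns show ?thesis using member_le_sum_list by (auto simp: A_def)
      qed
      with ss show "ss \<in> {ss. set ss \<subseteq> {t. nverts t \<le> N} \<and> length ss = m}"
        by (auto simp: B_def)
    qed
    then have finB: "finite (B m ns)"
      using finite_lists_length_eq[OF finite_nverts_le] finite_subset by blast
    have yB: "map y ks \<in> B m ns" using ks y by (auto simp: B_def)
    have "(\<Sum>t | nverts t = m. \<Sum>ss\<in>B m ns. a t * (\<Prod>i<m. b (ss ! i)) * I t ss ns) =
        (\<Sum>ss\<in>B m ns. a (x (m - 1)) * (\<Prod>i<m. b (ss ! i)) * I (x (m - 1)) ss ns)"
    proof (rule sum_eq_single[OF fin])
      show "x (m - 1) \<in> {t. nverts t = m}" using xm by simp
      fix t assume t: "t \<in> {t. nverts t = m}" "t \<noteq> x (m - 1)"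
      have "t \<notin> range x"
      proof
        assume "t \<in> range x"
        then obtain n where "t = x n" by blast
        with t x show False by auto
      qed
      then show "(\<Sum>ss\<in>B m ns. a t * (\<Prod>i<m. b (ss ! i)) * I t ss ns) = 0" by (simp add: a)
    qed
    also have "\<dots> = a (x (m - 1)) * (\<Prod>i<m. b (map y ks ! i)) * I (x (m - 1)) (map y ks) ns"
    proof (rule sum_eq_single[OF finB yB])
      fix ss assume ss: "ss \<in> B m ns" "ss \<noteq> map y ks"
      \<comment> \<open>A list drawn entirely from the family would be forced by its sizes to equal
        \<open>map y ks\<close>; any other list therefore has a factor 0.\<close>
      have "\<exists>i<m. ss ! i \<notin> range y"
      proof (rule ccontr)
        assume "\<not> ?thesis"
        then have *: "\<exists>k. ss ! i = y k" if "i < m" for i using that by blast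
        have "ss ! i = map y ks ! i" if i: "i < m" for i
        proof -
          from *[OF i] obtain k where k: "ss ! i = y k" ..
          have "Suc k = ns ! i" using k y ss i by (auto simp: B_def)
          also have "\<dots> = Suc (ks ! i)" using ks i by (metis nth_map)
          finally show ?thesis using k ks i by simp
        qed
        with ss ks show False by (auto simp: B_def list_eq_iff_nth_eq)
      qed
      then have "(\<Prod>i<m. b (ss ! i)) = 0" using b by auto
      then show "a (x (m - 1)) * (\<Prod>i<m. b (ss ! i)) * I (x (m - 1)) ss ns = 0" by simp
    qed
    also have "(\<Prod>i<m. b (map y ks ! i)) = prod_list (map (b \<circ> y) ks)"
      using ks by (simp add: prod.list_conv_set_nth atLeast0LessThan)
    finally show ?thesis using ks by (simp add: G_def ks_def)
  qed
  have finA: "finite (A m)" for m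
  proof (rule finite_subset)
    show "A m \<subseteq> {ns. set ns \<subseteq> {..N} \<and> length ns = m}"
      using member_le_sum_list by (fastforce simp: A_def)
    show "finite {ns. set ns \<subseteq> {..N} \<and> length ns = m}"
      by (rule finite_lists_length_eq) simp
  qed
  let ?K = "{ks. ks \<noteq> [] \<and> sum_list (map Suc ks) = N}"
  have finK: "finite ?K"
  proof (rule finite_subset)
    show "?K \<subseteq> {ks. set ks \<subseteq> {..N} \<and> length ks \<le> N}"
    proof clarify
      fix ks assume N: "N = sum_list (map Suc ks)"
      have "k \<le> sum_list (map Suc ks)" if "k \<in> set ks" for k
        using member_le_sum_list[of "Suc k" "map Suc ks"] that by auto
      with N length_le_sum_list_Suc show "set ks \<subseteq> {..sum_list (map Suc ks)} \<and>
          length ks \<le> sum_list (map Suc ks)" by blast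
    qed
    show "finite {ks. set ks \<subseteq> {..N} \<and> length ks \<le> N}"
      by (rule finite_lists_length_le) simp
  qed
  have "nap_mult a b u = (\<Sum>m\<in>{1..N}. \<Sum>ns\<in>A m. G (map (\<lambda>n. n - 1) ns))"
    unfolding nap_mult_def N_def[symmetric] A_def[symmetric] B_def[symmetric] I_def[symmetric]
    by (intro sum.cong refl inner)
  also have "\<dots> = (\<Sum>(m, ns)\<in>Sigma {1..N} A. G (map (\<lambda>n. n - 1) ns))"
    by (rule sum.Sigma) (auto simp: finA)
  also have "\<dots> = (\<Sum>ks\<in>?K. G ks)"
  \<comment> \<open>The outer index \<open>m\<close> is the length of \<open>ns\<close>, so the
    double sum is a single sum over lists.\<close>
  proof (rule sum.reindex_bij_witness[of _ "\<lambda>ks. (length ks, map Suc ks)"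
        "\<lambda>(m, ns). map (\<lambda>n. n - 1) ns"])
    fix p assume "p \<in> Sigma {1..N} A"
    then obtain m ns where p: "p = (m, ns)" "m \<in> {1..N}" "ns \<in> A m" by auto
    have "map Suc (map (\<lambda>n. n - 1) ns) = ns"
      unfolding map_map by (rule map_idI) (use p in \<open>auto simp: A_def\<close>)
    with p show "(length (case p of (m, ns) \<Rightarrow> map (\<lambda>n. n - 1) ns),
        map Suc (case p of (m, ns) \<Rightarrow> map (\<lambda>n. n - 1) ns)) = p"
      and "(case p of (m, ns) \<Rightarrow> map (\<lambda>n. n - 1) ns) \<in> ?K"
      by (auto simp: A_def)
    show "G (case p of (m, ns) \<Rightarrow> map (\<lambda>n. n - 1) ns) =
        (case p of (m, ns) \<Rightarrow> G (map (\<lambda>n. n - 1) ns))" by (simp add: p)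
  next
    fix ks assume "ks \<in> ?K"
    then show "(length ks, map Suc ks) \<in> Sigma {1..N} A"
      using length_le_sum_list_Suc[of ks] by (auto simp: A_def Suc_le_eq)
    show "(case (length ks, map Suc ks) of (m, ns) \<Rightarrow> map (\<lambda>n. n - 1) ns) = ks"
      by (simp add: o_def)
  qed
  also have "\<dots> = (\<Sum>ks\<in>{ks \<in> ?K. forget (compose (rep (x (length ks - 1))) (map (rep \<circ> y) ks)
      (map Suc ks)) = u}. a (x (length ks - 1)) * prod_list (map (b \<circ> y) ks))"
    unfolding sum.inter_filter[OF finK] by (intro sum.cong) (auto simp: G_def I_def)
  finally show ?thesis by (simp add: N_def conj_assoc)
qed

text \<open>Here \<open>c\<close> reads a list in the natural order of the tree and \<open>p\<close>
  translates from the label order of the chosen representative. The constraint on the vertex count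
  and the weight are unchanged by permuting entries.\<close>

lemma nap_mult_families_permuted:
  assumes x: "\<And>n. nverts (x n) = Suc n" and y: "\<And>n. nverts (y n) = Suc n"
    and a: "\<And>u. u \<notin> range x \<Longrightarrow> a u = 0" and b: "\<And>u. u \<notin> range y \<Longrightarrow> b u = 0"
    and c: "\<And>n. \<exists>p. p permutes {..<Suc n} \<and> (\<forall>ks. length ks = Suc n \<longrightarrow>
      forget (compose (rep (x n)) (map (rep \<circ> y) ks) (map Suc ks)) = c (permute_list p ks))"
  shows "nap_mult a b u = (\<Sum>ks | ks \<noteq> [] \<and> sum_list (map Suc ks) = nverts u \<and> c ks = u.
      a (x (length ks - 1)) * prod_list (map (b \<circ> y) ks))"
proof -
  obtain P where P: "\<And>n. P n permutes {..<Suc n}"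
    and c: "\<And>n ks. length ks = Suc n \<Longrightarrow>
      forget (compose (rep (x n)) (map (rep \<circ> y) ks) (map Suc ks)) = c (permute_list (P n) ks)"
    using c by metis
  define p where "p ks = P (length ks - 1)" for ks :: "nat list"
  have p: "p ks permutes {..<length ks}" if "ks \<noteq> []" for ks
    using P[of "length ks - 1"] that by (simp add: p_def)
  \<comment> \<open>Permuting a list keeps its length and hence the permutation assigned to it; this
    makes the two reindexing maps mutually inverse.\<close>
  have p_cong: "p ks = p ks'" if "length ks = length ks'" for ks ks'
    using that by (simp add: p_def)
  have Pc: "forget (compose (rep (x (length ks - 1))) (map (rep \<circ> y) ks) (map Suc ks)) =
      c (permute_list (p ks) ks)" if "ks \<noteq> []" for ks
    using c[of ks "length ks - 1"] that by (simp add: p_def)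
  have sum_inv: "sum_list (map Suc (permute_list q ks)) = sum_list (map Suc ks)"
    and prod_inv: "prod_list (map (b \<circ> y) (permute_list q ks)) = prod_list (map (b \<circ> y) ks)"
    if "q permutes {..<length ks}" for q ks
    using that by (simp_all flip: sum_mset_sum_list prod_mset_prod_list)
  have eq: "nap_mult a b u =
    (\<Sum>ks | ks \<noteq> [] \<and> sum_list (map Suc ks) = nverts u \<and>
        forget (compose (rep (x (length ks - 1))) (map (rep \<circ> y) ks) (map Suc ks)) = u.
      a (x (length ks - 1)) * prod_list (map (b \<circ> y) ks))"
    by (rule nap_mult_families) (simp_all add: x y a b)
  show ?thesis
    unfolding eq
  proof (rule sum.reindex_bij_witness[of _ "\<lambda>ks. permute_list (inv (p ks)) ks"
        "\<lambda>ks. permute_list (p ks) ks"], goal_cases)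
    case (1 ks)
    then have q: "p ks permutes {..<length ks}" using p by blast
    have "p (permute_list (p ks) ks) = p ks" by (rule p_cong) simp
    then show ?case
      using permute_list_compose[OF permutes_inv[OF q], of "p ks"]
      by (simp add: permutes_inv_o[OF q])
  next
    case (2 ks)
    then have q: "p ks permutes {..<length ks}" using p by blast
    have "permute_list (p ks) ks \<noteq> []" using 2 by (simp flip: length_greater_0_conv)
    with 2 show ?case using Pc[of ks] by (simp add: sum_inv[OF q])
  next
    case (3 ks)
    then have q: "p ks permutes {..<length ks}" using p by blast
    have "p (permute_list (inv (p ks)) ks) = p ks" by (rule p_cong) simp
    then show ?case
      using permute_list_compose[OF q, of "inv (p ks)"]
      by (simp add: permutes_inv_o[OF q])
  next
    case (4 ks)
    then have ne: "ks \<noteq> []" and q: "p ks permutes {..<length ks}" using p by blast+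
    have pp: "p (permute_list (inv (p ks)) ks) = p ks" by (rule p_cong) simp
    have ne': "permute_list (inv (p ks)) ks \<noteq> []"
      using ne by (simp flip: length_greater_0_conv)
    have "permute_list (p ks) (permute_list (inv (p ks)) ks) = ks"
      using permute_list_compose[OF q, of "inv (p ks)"] by (simp add: permutes_inv_o[OF q])
    with 4 ne' show ?case using Pc[OF ne'] by (simp add: sum_inv[OF permutes_inv[OF q]] pp)
  next
    case (5 ks)
    then have q: "p ks permutes {..<length ks}" using p by blast
    show ?case by (simp add: prod_inv[OF q])
  qed
qed

section \<open>Sign-reversing involutions\<close>

text \<open>Reindexing by \<phi> shows that the sum equals its own negative. Fixed points are
  harmless, as their weight equals its own negative too.\<close>

lemma sum_sign_reversing_involution:
  fixes f :: "'a \<Rightarrow> rat"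
  assumes "\<And>x. x \<in> A \<Longrightarrow> \<phi> x \<in> A" "\<And>x. x \<in> A \<Longrightarrow> \<phi> (\<phi> x) = x"
    and "\<And>x. x \<in> A \<Longrightarrow> f (\<phi> x) = - f x"
  shows "sum f A = 0"
proof -
  have "sum f A = (\<Sum>x\<in>A. f (\<phi> x))"
    by (rule sum.reindex_bij_witness[of _ \<phi> \<phi>]) (use assms in auto)
  also have "\<dots> = - sum f A" using assms(3) by (simp add: sum_negf)
  finally show ?thesis by simp
qed

primrec caterpillar :: "nat list \<Rightarrow> rtree" where
  "caterpillar [] = Node {#}"
| "caterpillar (k # ks) =
    Node (replicate_mset k (Node {#}) + (if ks = [] then {#} else {#caterpillar ks#}))"

text \<open>A leaf at the end of the spine of a caterpillar may or may not be counted as its last spine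
  vertex.\<close>
primrec toggle_spine :: "nat list \<Rightarrow> nat list" where
  "toggle_spine [] = []"
| "toggle_spine (k # ks) =
    (if ks = [] then (case k of 0 \<Rightarrow> [0] | Suc j \<Rightarrow> [j, 0])
     else if ks = [0] then [Suc k] else k # toggle_spine ks)"

text \<open>The sign flips because the length changes by one. The claims that the result is neither
  \<open>[]\<close> nor \<open>[0]\<close> are carried through the induction so that a second
  application to \<open>k # toggle_spine ks\<close> again takes the recursive branch.\<close>

lemma toggle_spine:
  assumes "ks \<noteq> []" "ks \<noteq> [0]"
  shows "caterpillar (toggle_spine ks) = caterpillar ks"
    and "toggle_spine (toggle_spine ks) = ks"
    and "toggle_spine ks \<noteq> []"
    and "toggle_spine ks \<noteq> [0]"
    and "sum_list (map Suc (toggle_spine ks)) = sum_list (map Suc ks)"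
    and "(-1 :: rat) ^ length (toggle_spine ks) = - ((-1) ^ length ks)"
  using assms
  by (induction ks) (auto split: nat.splits if_splits)

text \<open>The first entry is the path put at the centre of the corolla. Its first vertex is the
  root itself, so \<open>Suc j\<close> leaves the branch \<open>lin j\<close>, whereas every later
  entry is attached as a whole path.\<close>

fun star :: "nat list \<Rightarrow> rtree" where
  "star [] = Node {#}"
| "star (k # ks) = Node (mset (map lin ks) + (case k of 0 \<Rightarrow> {#} | Suc j \<Rightarrow> {#lin j#}))"

text \<open>The branch of the root path may be split off as the first of the attached paths.\<close>
fun toggle_branch :: "nat list \<Rightarrow> nat list" where
  "toggle_branch (0 # j # ks) = Suc j # ks"
| "toggle_branch (Suc j # ks) = 0 # j # ks"
| "toggle_branch ks = ks"

text \<open>The lists \<open>Suc j # ks\<close> and \<open>0 # j # ks\<close> both give the root a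
  branch \<open>lin j\<close>. The sum of the entries differs by one, which flips the sign, and the
  extra list entry restores the vertex count.\<close>

lemma toggle_branch:
  assumes "ks \<noteq> []" "ks \<noteq> [0]"
  shows "star (toggle_branch ks) = star ks"
    and "toggle_branch (toggle_branch ks) = ks"
    and "toggle_branch ks \<noteq> []"
    and "sum_list (map Suc (toggle_branch ks)) = sum_list (map Suc ks)"
    and "prod_list (map (\<lambda>k. (-1 :: rat) ^ k) (toggle_branch ks)) = - prod_list (map (\<lambda>k. (-1) ^ k) ks)"
  using assms by (induction ks rule: toggle_branch.induct) auto

section \<open>Composing corollas and paths\<close>

text \<open>One explicit labelled tree of shape \<open>u\<close> is enough to make the choice in
  \<open>rep\<close> meaningful.\<close>

lemma rep_correct:
  assumes "is_rtree_on {0..<nverts u} T" "forget T = u"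
  shows "is_rtree_on {0..<nverts u} (rep u)" "forget (rep u) = u"
  using someI[of "\<lambda>T. is_rtree_on {0..<nverts u} T \<and> forget T = u" T] assms
  unfolding rep_def by auto

lemma nverts_corolla: "nverts (corolla n) = Suc n"
  by (simp add: corolla_def)

lemma nverts_lin: "nverts (lin n) = Suc n"
  by (induction n) auto

lemma rep_corolla:
  "is_rtree_on {0..<Suc n} (rep (corolla n))" "forget (rep (corolla n)) = corolla n"
proof -
  \<comment> \<open>The witness is the star with centre \<open>0\<close>; the label itself serves as
    depth, since it only has to decrease towards the parent.\<close>
  interpret parent_tree "{0..<Suc n}" 0 "\<lambda>_. 0" "\<lambda>v. v" by unfold_locales auto
  have "kids v = (if v = 0 then {1..n} else {})" for v
    by (auto simp: kids_def)
  moreover have "image_mset (\<lambda>v. if v = 0 then corolla n else Node {#}) (mset_set {1..n}) =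
      image_mset (\<lambda>_. Node {#}) (mset_set {1..n})"
    by (rule image_mset_cong) auto
  ultimately have "shape_fun (\<lambda>v. if v = 0 then corolla n else Node {#})"
    unfolding shape_fun_def by (auto simp: corolla_def image_mset_const_eq)
  note forget_edges[OF this]
  with is_rtree_on_edges rep_correct[of "corolla n" "(0, edges)"]
  show "is_rtree_on {0..<Suc n} (rep (corolla n))" "forget (rep (corolla n)) = corolla n"
    by (simp_all add: nverts_corolla)
qed

lemma rep_lin: "is_rtree_on {0..<Suc n} (rep (lin n))" "forget (rep (lin n)) = lin n"
proof -
  interpret parent_tree "{0..<Suc n}" 0 "\<lambda>v. v - 1" "\<lambda>v. v" by unfold_locales auto
  have "kids v = (if v < n then {Suc v} else {})" for v
    unfolding kids_def by auto
  then have "shape_fun (\<lambda>v. lin (n - v))"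
    unfolding shape_fun_def by (auto simp: Suc_diff_Suc simp flip: lin.simps(2))
  note forget_edges[OF this]
  with is_rtree_on_edges rep_correct[of "lin n" "(0, edges)"]
  show "is_rtree_on {0..<Suc n} (rep (lin n))" "forget (rep (lin n)) = lin n"
    by (simp_all add: nverts_lin)
qed

text \<open>\<open>H i\<close> is the shape of the composite below the root of component
  \<open>i\<close>: the component's own branches together with the values at the children of
  \<open>i\<close> in \<open>t\<close>.\<close>

lemma forget_compose_rtrees:
  assumes t: "parent_tree {0..<m} (fst t) part dt"
    and tE: "snd t = parent_tree.edges {0..<m} (fst t) part"
    and len: "length ss = m" "length ns = m"
    and s: "\<And>i. i < m \<Longrightarrow> is_rtree_on {0..<ns ! i} (ss ! i)"
    and M: "\<And>i. i < m \<Longrightarrow> forget (ss ! i) = Node (M i)"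
  obtains H where "forget (compose t ss ns) = H (fst t)"
    "\<And>i. H i = Node (M i + image_mset H (mset_set (parent_tree.kids {0..<m} (fst t) part i)))"
proof -
  have "\<exists>par d g. parent_tree {0..<ns ! i} (fst (ss ! i)) par d \<and>
      snd (ss ! i) = parent_tree.edges {0..<ns ! i} (fst (ss ! i)) par \<and>
      parent_tree.shape_fun {0..<ns ! i} (fst (ss ! i)) par g" if "i < m" for i
    using parent_tree_if_is_rtree_on[OF s[OF that]] parent_tree.shape_fun_exists by metis
  then obtain par d g where "\<And>i. i < m \<Longrightarrow> parent_tree {0..<ns ! i} (fst (ss ! i)) (par i) (d i)"
    "\<And>i. i < m \<Longrightarrow> snd (ss ! i) = parent_tree.edges {0..<ns ! i} (fst (ss ! i)) (par i)"
    "\<And>i. i < m \<Longrightarrow> parent_tree.shape_fun {0..<ns ! i} (fst (ss ! i)) (par i) (g i)"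
    by metis
  note s = this
  obtain H where
    "\<And>i. H i = Node (M i + image_mset H (mset_set (parent_tree.kids {0..<m} (fst t) part i)))"
    using parent_tree.tree_recursion[OF t, of "\<lambda>v X. Node (M v + X)"] by blast
  with forget_compose[OF t tE len s M] that show thesis by blast
qed

text \<open>Turns an order in which the labels of a tree are visited into the permutation that
  brings a label-indexed list into that order.\<close>

lemma permute_list_enumeration:
  assumes "distinct vs" "set vs = {0..<n}"
  obtains p where "p permutes {..<n}"
    "\<And>ks :: 'a list. length ks = n \<Longrightarrow> permute_list p ks = map ((!) ks) vs"
proof -
  have len: "length vs = n" using assms distinct_card by fastforce
  define p where "p i = (if i < n then vs ! i else i)" for i
  have "bij_betw ((!) vs) {..<n} {..<n}"
    by (rule bij_betw_nth) (simp_all only: assms len atLeast0LessThan)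
  moreover have "bij_betw p {..<n} {..<n} \<longleftrightarrow> bij_betw ((!) vs) {..<n} {..<n}"
    by (rule bij_betw_cong) (simp add: p_def)
  ultimately have "bij_betw p {..<n} {..<n}" by blast
  then have "p permutes {..<n}" by (rule bij_imp_permutes) (simp add: p_def)
  moreover have "permute_list p ks = map ((!) ks) vs" if "length ks = n" for ks :: "'a list"
    using that len by (auto simp: permute_list_def p_def list_eq_iff_nth_eq)
  ultimately show thesis by (rule that)
qed

text \<open>The labelling is unknown, but its shape shows that the root has \<open>n\<close>
  children, hence all other vertices. The permutation puts the root's entry first.\<close>

lemma compose_corolla_lin:
  "\<exists>p. p permutes {..<Suc n} \<and> (\<forall>ks. length ks = Suc n \<longrightarrow>
    forget (compose (rep (corolla n)) (map (rep \<circ> lin) ks) (map Suc ks)) = star (permute_list p ks))"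
proof -
  define r where "r = fst (rep (corolla n))"
  obtain par d where t: "parent_tree {0..<Suc n} r par d"
    and tE: "snd (rep (corolla n)) = parent_tree.edges {0..<Suc n} r par"
    using parent_tree_if_is_rtree_on[OF rep_corolla(1)] unfolding r_def by metis
  interpret parent_tree "{0..<Suc n}" r par d by (rule t)
  obtain g where g: "shape_fun g" using shape_fun_exists by blast
  have "g r = corolla n"
    using forget_edges[OF g] rep_corolla(2)[of n] tE r_def by (metis prod.collapse)
  then have "image_mset g (mset_set (kids r)) = replicate_mset n (Node {#})"
    using g root_in by (simp add: shape_fun_def corolla_def)
  then have "card (kids r) = n" by (metis size_image_mset size_mset_set size_replicate_mset)
  then have kids_r: "kids r = {0..<Suc n} - {r}"
    using root_in by (intro card_subset_eq kids_subset) auto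
  have kids_other: "kids v = {}" if "v \<noteq> r" for v
  proof -
    have "w \<in> kids r" if "w \<in> kids v" for w using that kids_subset kids_r by blast
    with that show ?thesis unfolding kids_def by blast
  qed
  \<comment> \<open>Any order of the leaves would do, since \<open>star\<close> collects the
    attached paths in a multiset.\<close>
  define ws where "ws = sorted_list_of_set ({0..<Suc n} - {r})"
  have "distinct (r # ws)" "set (r # ws) = {0..<Suc n}"
    using root_in by (auto simp: ws_def)
  then obtain p where p: "p permutes {..<Suc n}"
    "\<And>ks :: nat list. length ks = Suc n \<Longrightarrow> permute_list p ks = map ((!) ks) (r # ws)"
    by (rule permute_list_enumeration) blast
  have "forget (compose (rep (corolla n)) (map (rep \<circ> lin) ks) (map Suc ks)) =
      star (permute_list p ks)" if ks: "length ks = Suc n" for ks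
  proof -
    define M where "M i = (case ks ! i of 0 \<Rightarrow> {#} | Suc j \<Rightarrow> {#lin j#})" for i
    have lin_M: "lin (ks ! i) = Node (M i)" for i by (simp add: M_def split: nat.split)
    obtain H where H: "forget (compose (rep (corolla n)) (map (rep \<circ> lin) ks) (map Suc ks)) = H r"
      "\<And>i. H i = Node (M i + image_mset H (mset_set (kids i)))"
      by (rule forget_compose_rtrees[of "Suc n" "rep (corolla n)" par d
            "map (rep \<circ> lin) ks" "map Suc ks" M])
        (use t tE ks rep_lin in \<open>auto simp: r_def simp flip: lin_M\<close>)
    have "image_mset H (mset_set (kids r)) = image_mset (\<lambda>i. lin (ks ! i)) (mset_set (kids r))"
    proof (rule image_mset_cong)
      fix i assume "i \<in># mset_set (kids r)"
      then have "i \<noteq> r" using kids_r by auto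
      then show "H i = lin (ks ! i)" using H(2)[of i] by (simp add: kids_other lin_M)
    qed
    moreover have "mset_set (kids r) = mset ws"
      unfolding kids_r ws_def by (simp only: mset_sorted_list_of_multiset sorted_list_of_mset_set[symmetric])
    ultimately have "H r = Node (M r + mset (map (\<lambda>i. lin (ks ! i)) ws))"
      using H(2)[of r] by simp
    then show ?thesis
      using H(1) p(2)[OF ks] by (simp add: M_def o_def)
  qed
  with p(1) show ?thesis by blast
qed

section \<open>Unbranched paths from a vertex down to a leaf\<close>

primrec chain :: "('a \<Rightarrow> 'a set) \<Rightarrow> 'a list \<Rightarrow> bool" where
  "chain K [] \<longleftrightarrow> True"
| "chain K (v # vs) \<longleftrightarrow> K v = (if vs = [] then {} else {hd vs}) \<and> chain K vs"

text \<open>The image multiset has as many elements as there are children, so a linear shape leaves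
  exactly one child at each step until a leaf is reached.\<close>

lemma (in parent_tree) chain_if_lin:
  assumes g: "shape_fun g" and "v \<in> V" "g v = lin k"
  shows "\<exists>vs. length vs = k \<and> set vs \<subseteq> V \<and> chain kids (v # vs)"
  using assms(2,3)
proof (induction k arbitrary: v)
  case 0
  then have "image_mset g (mset_set (kids v)) = {#}" using g by (simp add: shape_fun_def)
  then have "kids v = {}" by (simp add: mset_set_empty_iff)
  then show ?case by simp
next
  case (Suc k)
  then have *: "image_mset g (mset_set (kids v)) = {#lin k#}" using g by (simp add: shape_fun_def)
  then have "card (kids v) = 1" by (metis size_image_mset size_mset_set size_single)
  then obtain w where w: "kids v = {w}" by (rule card_1_singletonE)
  with * have "g w = lin k" by simp
  moreover have "w \<in> V" using w kids_subset by blast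
  ultimately obtain vs where "length vs = k" "set vs \<subseteq> V" "chain kids (w # vs)"
    using Suc.IH by blast
  with w \<open>w \<in> V\<close> show ?case by (intro exI[of _ "w # vs"]) simp
qed

lemma (in parent_tree) depth_chain:
  "chain kids (v # vs) \<Longrightarrow> w \<in> set vs \<Longrightarrow> d v < d w"
proof (induction vs arbitrary: v)
  case (Cons x vs)
  then have "d v < d x" using depth_kids by simp
  then show ?case using Cons by fastforce
qed simp

lemma (in parent_tree) distinct_chain: "chain kids vs \<Longrightarrow> distinct vs"
proof (induction vs)
  case (Cons v vs)
  then show ?case using depth_chain[OF Cons.prems, of v] by auto
qed simp

lemma chain_caterpillar:
  assumes "\<And>i. H i = Node (replicate_mset (f i) (Node {#}) + image_mset H (mset_set (K i)))"
  shows "chain K (v # vs) \<Longrightarrow> H v = caterpillar (map f (v # vs))"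
proof (induction vs arbitrary: v)
  case Nil
  then show ?case using assms[of v] by simp
next
  case (Cons w vs)
  then have "K v = {w}" "H w = caterpillar (map f (w # vs))" by simp_all
  then show ?case using assms[of v] by simp
qed

text \<open>Following only children from the root meets \<open>Suc n\<close> labels, distinct
  because depth increases, hence all labels. Their order along the path is the required
  permutation.\<close>

lemma compose_lin_corolla:
  "\<exists>p. p permutes {..<Suc n} \<and> (\<forall>ks. length ks = Suc n \<longrightarrow>
    forget (compose (rep (lin n)) (map (rep \<circ> corolla) ks) (map Suc ks)) =
      caterpillar (permute_list p ks))"
proof -
  define r where "r = fst (rep (lin n))"
  obtain par d where t: "parent_tree {0..<Suc n} r par d"
    and tE: "snd (rep (lin n)) = parent_tree.edges {0..<Suc n} r par"
    using parent_tree_if_is_rtree_on[OF rep_lin(1)] unfolding r_def by metis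
  interpret parent_tree "{0..<Suc n}" r par d by (rule t)
  obtain g where g: "shape_fun g" using shape_fun_exists by blast
  have "g r = lin n"
    using forget_edges[OF g] rep_lin(2)[of n] tE r_def by (metis prod.collapse)
  with chain_if_lin[OF g root_in] obtain vs where
    vs: "length vs = n" "set vs \<subseteq> {0..<Suc n}" "chain kids (r # vs)" by blast
  have dist: "distinct (r # vs)" using distinct_chain[OF vs(3)] .
  have "card (set (r # vs)) = Suc n" using distinct_card[OF dist] vs(1) by simp
  then have "set (r # vs) = {0..<Suc n}"
    using vs(2) root_in by (intro card_subset_eq) auto
  with dist obtain p where p: "p permutes {..<Suc n}"
    "\<And>ks :: nat list. length ks = Suc n \<Longrightarrow> permute_list p ks = map ((!) ks) (r # vs)"
    by (rule permute_list_enumeration) blast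
  have "forget (compose (rep (lin n)) (map (rep \<circ> corolla) ks) (map Suc ks)) =
      caterpillar (permute_list p ks)" if ks: "length ks = Suc n" for ks
  proof -
    obtain H where H: "forget (compose (rep (lin n)) (map (rep \<circ> corolla) ks) (map Suc ks)) = H r"
      "\<And>i. H i = Node (replicate_mset (ks ! i) (Node {#}) + image_mset H (mset_set (kids i)))"
      by (rule forget_compose_rtrees[of "Suc n" "rep (lin n)" par d
            "map (rep \<circ> corolla) ks" "map Suc ks" "\<lambda>i. replicate_mset (ks ! i) (Node {#})"])
        (use t tE ks rep_corolla in \<open>auto simp: r_def simp flip: corolla_def\<close>)
    show ?thesis
      using H(1) chain_caterpillar[OF H(2) vs(3)] p(2)[OF ks] by simp
  qed
  with p(1) show ?thesis by blast
qed

section \<open>The two products\<close>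

text \<open>The involution preserves \<open>c\<close> and so acts on the lists describing one fixed
  tree. For a tree other than the single vertex, \<open>[0]\<close> is not among these lists, and
  they cancel; for the single vertex, the size forces \<open>[0]\<close>.\<close>

lemma nap_mult_sign_reversing:
  fixes c :: "nat list \<Rightarrow> rtree" and w :: "nat list \<Rightarrow> rat"
  assumes mult: "\<And>u. nap_mult a b u =
      (\<Sum>ks | ks \<noteq> [] \<and> sum_list (map Suc ks) = nverts u \<and> c ks = u. w ks)"
    and base: "c [0] = Node {#}" "w [0] = 1"
    and \<phi>: "\<And>ks. ks \<noteq> [] \<Longrightarrow> ks \<noteq> [0] \<Longrightarrow> c (\<phi> ks) = c ks \<and> \<phi> (\<phi> ks) = ks \<and> \<phi> ks \<noteq> [] \<and>
      sum_list (map Suc (\<phi> ks)) = sum_list (map Suc ks) \<and> w (\<phi> ks) = - w ks"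
  shows "nap_mult a b = nap_one"
proof
  fix u
  let ?A = "{ks. ks \<noteq> [] \<and> sum_list (map Suc ks) = nverts u \<and> c ks = u}"
  show "nap_mult a b u = nap_one u"
  proof (cases "u = Node {#}")
    case True
    have "ks = [0]" if "ks \<noteq> []" "sum_list (map Suc ks) = 1" for ks
      using that by (cases ks) auto
    with True base have "?A = {[0]}" by auto
    then show ?thesis using mult base True by (simp add: nap_one_def)
  next
    case False
    then have "[0] \<notin> ?A" using base by auto
    have "sum w ?A = 0"
    proof (rule sum_sign_reversing_involution[of _ \<phi>])
      fix ks assume ks: "ks \<in> ?A"
      with \<open>[0] \<notin> ?A\<close> have "ks \<noteq> []" "ks \<noteq> [0]" by blast+
      from \<phi>[OF this] ks show "\<phi> ks \<in> ?A" "\<phi> (\<phi> ks) = ks" "w (\<phi> ks) = - w ks" by auto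
    qed
    then show ?thesis using mult False by (simp add: nap_one_def)
  qed
qed

text \<open>The vertex count makes the index of a path unique, which evaluates the definite
  description in \<open>L_series\<close>.\<close>

lemma L_series_lin: "L_series (lin n) = (-1) ^ n"
proof -
  have "lin n = lin k \<longleftrightarrow> k = n" for k using nverts_lin by (metis Suc_inject)
  then show ?thesis by (auto simp: L_series_def)
qed

theorem theorem6p14:
  shows "C_series \<in> G_NAP \<and> L_series \<in> G_NAP \<and>
         nap_mult L_series C_series = nap_one \<and> nap_mult C_series L_series = nap_one"
proof (intro conjI)
  have C: "C_series (corolla n) = 1" for n by (auto simp: C_series_def)
  show "C_series \<in> G_NAP" using C[of 0] by (simp add: G_NAP_def corolla_def)
  show "L_series \<in> G_NAP" using L_series_lin[of 0] by (simp add: G_NAP_def)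
  have C0: "u \<notin> range corolla \<Longrightarrow> C_series u = 0" and L0: "u \<notin> range lin \<Longrightarrow> L_series u = 0" for u
    by (auto simp: C_series_def L_series_def)
  show "nap_mult L_series C_series = nap_one"
  proof (rule nap_mult_sign_reversing[where c = caterpillar and \<phi> = toggle_spine and
        w = "\<lambda>ks. (-1) ^ (length ks - 1)"])
    fix u
    have "nap_mult L_series C_series u =
        (\<Sum>ks | ks \<noteq> [] \<and> sum_list (map Suc ks) = nverts u \<and> caterpillar ks = u.
          L_series (lin (length ks - 1)) * prod_list (map (C_series \<circ> corolla) ks))"
      by (rule nap_mult_families_permuted)
        (simp_all add: nverts_lin nverts_corolla L0 C0 compose_lin_corolla)
    moreover have "prod_list (map (C_series \<circ> corolla) ks) = 1" for ks
      by (induction ks) (simp_all add: C)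
    ultimately show "nap_mult L_series C_series u =
        (\<Sum>ks | ks \<noteq> [] \<and> sum_list (map Suc ks) = nverts u \<and> caterpillar ks = u.
          (-1) ^ (length ks - 1))"
      by (simp add: L_series_lin)
  next
    fix ks :: "nat list" assume ks: "ks \<noteq> []" "ks \<noteq> [0]"
    \<comment> \<open>A path with \<open>m\<close> vertices has sign exponent \<open>m - 1\<close>,
      while \<open>toggle_spine\<close> is stated for the exponent \<open>m\<close>; on nonempty
      lists the two differ by a sign.\<close>
    have pow: "(-1 :: rat) ^ (length xs - 1) = - ((-1) ^ length xs)" if "xs \<noteq> []" for xs :: "nat list"
      using that by (cases xs) auto
    show "caterpillar (toggle_spine ks) = caterpillar ks \<and> toggle_spine (toggle_spine ks) = ks \<and>
        toggle_spine ks \<noteq> [] \<and> sum_list (map Suc (toggle_spine ks)) = sum_list (map Suc ks) \<and>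
        (-1 :: rat) ^ (length (toggle_spine ks) - 1) = - ((-1) ^ (length ks - 1))"
      unfolding pow[OF ks(1)] pow[OF toggle_spine(3)[OF ks]] using toggle_spine[OF ks] by simp
  qed simp_all
  show "nap_mult C_series L_series = nap_one"
  proof (rule nap_mult_sign_reversing[where c = star and \<phi> = toggle_branch and
        w = "\<lambda>ks. prod_list (map (\<lambda>k. (-1) ^ k) ks)"])
    fix u
    have "nap_mult C_series L_series u =
        (\<Sum>ks | ks \<noteq> [] \<and> sum_list (map Suc ks) = nverts u \<and> star ks = u.
          C_series (corolla (length ks - 1)) * prod_list (map (L_series \<circ> lin) ks))"
      by (rule nap_mult_families_permuted)
        (simp_all add: nverts_lin nverts_corolla L0 C0 compose_corolla_lin)
    then show "nap_mult C_series L_series u =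
        (\<Sum>ks | ks \<noteq> [] \<and> sum_list (map Suc ks) = nverts u \<and> star ks = u.
          prod_list (map (\<lambda>k. (-1) ^ k) ks))"
      by (simp add: L_series_lin C o_def)
  next
    fix ks :: "nat list" assume "ks \<noteq> []" "ks \<noteq> [0]"
    from toggle_branch[OF this]
    show "star (toggle_branch ks) = star ks \<and> toggle_branch (toggle_branch ks) = ks \<and>
        toggle_branch ks \<noteq> [] \<and> sum_list (map Suc (toggle_branch ks)) = sum_list (map Suc ks) \<and>
        prod_list (map (\<lambda>k. (-1 :: rat) ^ k) (toggle_branch ks)) =
          - prod_list (map (\<lambda>k. (-1) ^ k) ks)"
      by blast
  qed simp_all
qed

end
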